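(* There exist minimal ideal hypersurfaces in the Euclidean 4-space $\mathbb{E}^4$ with three distinct principal curvatures (at each point) which are non-rigid.
   Context: All manifolds and immersions are smooth. A hypersurface $M$ of $\mathbb{E}^4$ is a 3-dimensional Riemannian manifold isometrically immersed in $\mathbb{E}^4$. Its principal curvatures are the eigenvalues of its shape operator $A$, its squared mean curvature is $H^2=\big(\tfrac13\operatorname{trace}A\big)^2$, and it is minimal if $\operatorname{trace}A=0$ identically. For a Riemannian 3-manifold $M$ put $\delta_M(p)=\tau(p)-\inf K(p)$, where $\tau(p)=\sum_{i<j}K(e_i\wedge e_j)$ for any orthonormal basis $e_1,e_2,e_3$ of $T_pM$ is the scalar curvature, and $\inf K(p)$ is the infimum of the sectional curvatures $K(\pi)$ over all 2-planes $\pi\subset T_pM$. Every hypersurface of $\mathbb{E}^4$ satisfies $\delta_M\le \tfrac94H^2$. The hypersurface is called ideal if $\delta_M=\tfrac94H^2$ holds identically on $M$. Manifolds are connected. An isometric immersion of a Riemannian $n$-manifold into a Euclidean $m$-space $\mathbb{E}^m$ is called rigid if the isometric immersion is unique up to isometries of $\mathbb{E}^m$; non-rigid means not rigid. *)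

theory Defs
  imports "HOL-Analysis.Analysis"
begin

section \<open>Smooth maps between Euclidean spaces\<close>

definition partial_deriv :: "'n::finite \<Rightarrow> (real^'n \<Rightarrow> 'b::real_normed_vector) \<Rightarrow> real^'n \<Rightarrow> 'b" where
  "partial_deriv i f x = frechet_derivative f (at x) (axis i 1)"

text \<open>Only meaningful for open \<open>S\<close>: \<open>f\<close> has continuous partial derivatives of all orders up to \<open>k\<close>.\<close>

primrec Ck_on :: "nat \<Rightarrow> (real^'n::finite) set \<Rightarrow> (real^'n \<Rightarrow> 'b::real_normed_vector) \<Rightarrow> bool" where
  "Ck_on 0 S f \<longleftrightarrow> continuous_on S f"
| "Ck_on (Suc k) S f \<longleftrightarrow>
     (\<forall>x\<in>S. f differentiable (at x)) \<and> (\<forall>i. Ck_on k S (partial_deriv i f))"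

definition smooth_on :: "(real^'n::finite) set \<Rightarrow> (real^'n \<Rightarrow> 'b::real_normed_vector) \<Rightarrow> bool" where
  "smooth_on S f \<longleftrightarrow> (\<forall>k. Ck_on k S f)"

section \<open>Smooth and Riemannian manifolds\<close>

text \<open>A chart is a pair of its domain and its coordinate map; the coordinate map is only
  meaningful on the domain.\<close>

type_synonym ('a, 'n) chart = "'a set \<times> ('a \<Rightarrow> real^'n)"

definition chart_image :: "('a, 'n::finite) chart \<Rightarrow> (real^'n) set" where
  "chart_image c = snd c ` fst c"

definition chart_inv :: "('a, 'n::finite) chart \<Rightarrow> real^'n \<Rightarrow> 'a" where
  "chart_inv c = inv_into (fst c) (snd c)"

definition chart_on :: "'a topology \<Rightarrow> ('a, 'n::finite) chart \<Rightarrow> bool" where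
  "chart_on X c \<longleftrightarrow> openin X (fst c) \<and> open (chart_image c) \<and>
     homeomorphic_map (subtopology X (fst c)) (top_of_set (chart_image c)) (snd c)"

text \<open>The coordinate change from \<open>c\<close> to \<open>c'\<close>, a map on \<open>snd c ` (fst c \<inter> fst c')\<close>.\<close>

definition transition :: "('a, 'n::finite) chart \<Rightarrow> ('a, 'n) chart \<Rightarrow> real^'n \<Rightarrow> real^'n" where
  "transition c c' = snd c' \<circ> chart_inv c"

definition smooth_atlas :: "'a topology \<Rightarrow> ('a, 'n::finite) chart set \<Rightarrow> bool" where
  "smooth_atlas X \<A> \<longleftrightarrow>
     (\<forall>c\<in>\<A>. chart_on X c) \<and> (\<Union>c\<in>\<A>. fst c) = topspace X \<and>
     (\<forall>c\<in>\<A>. \<forall>c'\<in>\<A>. smooth_on (snd c ` (fst c \<inter> fst c')) (transition c c'))"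

text \<open>The tangent space at a point \<open>p\<close> of a chart \<open>c\<close> is identified with \<open>real^'n\<close> through the
  coordinate frame of \<open>c\<close>, and \<open>metric M c p\<close> is the Gram matrix of that frame.\<close>

record ('a, 'n) riem =
  space_of :: "'a topology"
  atlas :: "('a, 'n) chart set"
  metric :: "('a, 'n) chart \<Rightarrow> 'a \<Rightarrow> real^'n^'n"

definition gram :: "('a, 'n::finite) riem \<Rightarrow> ('a, 'n) chart \<Rightarrow> real^'n \<Rightarrow> real^'n^'n" where
  "gram M c x = metric M c (chart_inv c x)"

definition ginner :: "('a, 'n::finite) riem \<Rightarrow> ('a, 'n) chart \<Rightarrow> real^'n \<Rightarrow> real^'n \<Rightarrow> real^'n \<Rightarrow> real" where
  "ginner M c x u v = u \<bullet> (gram M c x *v v)"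

definition jacobian :: "(real^'n::finite \<Rightarrow> real^'n) \<Rightarrow> real^'n \<Rightarrow> real^'n^'n" where
  "jacobian f x = matrix (frechet_derivative f (at x))"

text \<open>Manifolds are connected (hence, here, nonempty), Hausdorff and second countable. The atlas
  need not be maximal.  All notions below are independent of the chart; they are
  evaluated at the points \<open>x\<close> of the image of a chart \<open>c\<close> of the atlas.\<close>

definition riemannian_manifold :: "('a, 'n::finite) riem \<Rightarrow> bool" where
  "riemannian_manifold M \<longleftrightarrow>
     topspace (space_of M) \<noteq> {} \<and> connected_space (space_of M) \<and> Hausdorff_space (space_of M) \<and>
     (\<exists>\<B>. countable \<B> \<and> openin (space_of M) = arbitrary union_of (\<lambda>U. U \<in> \<B>)) \<and>
     smooth_atlas (space_of M) (atlas M) \<and>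
     (\<forall>c\<in>atlas M. smooth_on (chart_image c) (gram M c)) \<and>
     (\<forall>c\<in>atlas M. \<forall>x\<in>chart_image c.
        transpose (gram M c x) = gram M c x \<and> (\<forall>v. v \<noteq> 0 \<longrightarrow> ginner M c x v v > 0)) \<and>
     (\<forall>c\<in>atlas M. \<forall>c'\<in>atlas M. \<forall>x\<in>snd c ` (fst c \<inter> fst c').
        gram M c x = transpose (jacobian (transition c c') x) **
          gram M c' (transition c c' x) ** jacobian (transition c c') x)"

section \<open>Curvature of a Riemannian manifold\<close>

text \<open>\<open>christoffel M c x k i j\<close> is the Christoffel symbol with upper index \<open>k\<close> of the Levi-Civita
  connection.\<close>

definition christoffel ::
    "('a, 'n::finite) riem \<Rightarrow> ('a, 'n) chart \<Rightarrow> real^'n \<Rightarrow> 'n \<Rightarrow> 'n \<Rightarrow> 'n \<Rightarrow> real" where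
  "christoffel M c x k i j =
     (1/2) * (\<Sum>l\<in>UNIV. matrix_inv (gram M c x) $ k $ l *
        (partial_deriv i (\<lambda>y. gram M c y $ j $ l) x + partial_deriv j (\<lambda>y. gram M c y $ i $ l) x
         - partial_deriv l (\<lambda>y. gram M c y $ i $ j) x))"

text \<open>\<open>riem_coeff M c x l i j k\<close> is the \<open>l\<close>-th component of \<open>R(\<partial>\<^sub>i, \<partial>\<^sub>j) \<partial>\<^sub>k\<close>, where
  \<open>R(X, Y) = [\<nabla>\<^sub>X, \<nabla>\<^sub>Y] - \<nabla>\<^bsub>[X, Y]\<^esub>\<close>.\<close>

definition riem_coeff ::
    "('a, 'n::finite) riem \<Rightarrow> ('a, 'n) chart \<Rightarrow> real^'n \<Rightarrow> 'n \<Rightarrow> 'n \<Rightarrow> 'n \<Rightarrow> 'n \<Rightarrow> real" where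
  "riem_coeff M c x l i j k =
     partial_deriv i (\<lambda>y. christoffel M c y l j k) x - partial_deriv j (\<lambda>y. christoffel M c y l i k) x
     + (\<Sum>m\<in>UNIV. christoffel M c x l i m * christoffel M c x m j k)
     - (\<Sum>m\<in>UNIV. christoffel M c x l j m * christoffel M c x m i k)"

definition curvature_op ::
    "('a, 'n::finite) riem \<Rightarrow> ('a, 'n) chart \<Rightarrow> real^'n \<Rightarrow> real^'n \<Rightarrow> real^'n \<Rightarrow> real^'n \<Rightarrow> real^'n" where
  "curvature_op M c x u v w =
     (\<chi> l. \<Sum>i\<in>UNIV. \<Sum>j\<in>UNIV. \<Sum>k\<in>UNIV. riem_coeff M c x l i j k * u $ i * v $ j * w $ k)"

text \<open>The sectional curvature of the plane spanned by linearly independent \<open>u\<close> and \<open>v\<close>.\<close>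

definition sectional ::
    "('a, 'n::finite) riem \<Rightarrow> ('a, 'n) chart \<Rightarrow> real^'n \<Rightarrow> real^'n \<Rightarrow> real^'n \<Rightarrow> real" where
  "sectional M c x u v = ginner M c x (curvature_op M c x u v v) u /
     (ginner M c x u u * ginner M c x v v - (ginner M c x u v)\<^sup>2)"

definition inf_K :: "('a, 'n::finite) riem \<Rightarrow> ('a, 'n) chart \<Rightarrow> real^'n \<Rightarrow> real" where
  "inf_K M c x = Inf {sectional M c x u v | u v. u \<noteq> v \<and> independent {u, v}}"

definition orthonormal_frame ::
    "('a, 'n::finite) riem \<Rightarrow> ('a, 'n) chart \<Rightarrow> real^'n \<Rightarrow> ('n \<Rightarrow> real^'n) \<Rightarrow> bool" where
  "orthonormal_frame M c x e \<longleftrightarrow> (\<forall>i j. ginner M c x (e i) (e j) = (if i = j then 1 else 0))"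

definition scalar_curvature ::
    "('a, 'n::{finite,linorder}) riem \<Rightarrow> ('a, 'n) chart \<Rightarrow> real^('n::{finite,linorder}) \<Rightarrow> real" where
  "scalar_curvature M c x = (THE t. \<forall>e. orthonormal_frame M c x e \<longrightarrow>
     t = (\<Sum>(i, j)\<in>{(i, j). i < j}. sectional M c x (e i) (e j)))"

definition delta ::
    "('a, 'n::{finite,linorder}) riem \<Rightarrow> ('a, 'n) chart \<Rightarrow> real^('n::{finite,linorder}) \<Rightarrow> real" where
  "delta M c x = scalar_curvature M c x - inf_K M c x"

section \<open>Isometric immersions into Euclidean space\<close>

definition local_rep :: "('a, 'n::finite) chart \<Rightarrow> ('a \<Rightarrow> real^'m::finite) \<Rightarrow> real^'n \<Rightarrow> real^'m" where
  "local_rep c f = f \<circ> chart_inv c"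

definition isometric_immersion :: "('a, 'n::finite) riem \<Rightarrow> ('a \<Rightarrow> real^'m::finite) \<Rightarrow> bool" where
  "isometric_immersion M f \<longleftrightarrow>
     (\<forall>c\<in>atlas M. smooth_on (chart_image c) (local_rep c f) \<and>
        (\<forall>x\<in>chart_image c. let df = frechet_derivative (local_rep c f) (at x) in
           inj df \<and> (\<forall>u v. df u \<bullet> df v = ginner M c x u v)))"

definition euclidean_isometry :: "(real^'m::finite \<Rightarrow> real^'m) \<Rightarrow> bool" where
  "euclidean_isometry \<Phi> \<longleftrightarrow> bij \<Phi> \<and> (\<forall>x y. dist (\<Phi> x) (\<Phi> y) = dist x y)"

definition rigid :: "('a, 'n::finite) riem \<Rightarrow> ('a \<Rightarrow> real^'m::finite) \<Rightarrow> bool" where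
  "rigid M f \<longleftrightarrow> (\<forall>f' :: 'a \<Rightarrow> real^'m. isometric_immersion M f' \<longrightarrow>
     (\<exists>\<Phi>. euclidean_isometry \<Phi> \<and> (\<forall>p\<in>topspace (space_of M). f' p = \<Phi> (f p))))"

section \<open>Hypersurfaces\<close>

text \<open>The second fundamental form \<open>h(\<partial>\<^sub>i, \<partial>\<^sub>j)\<close> is given by the Gauss formula: it is the difference of
  the Euclidean derivative and the image of the covariant derivative of \<open>\<partial>\<^sub>j\<close> along \<open>\<partial>\<^sub>i\<close>.\<close>

definition second_fundamental_form ::
    "('a, 'n::finite) riem \<Rightarrow> ('a \<Rightarrow> real^'m::finite) \<Rightarrow> ('a, 'n) chart \<Rightarrow> real^'n \<Rightarrow> 'n \<Rightarrow> 'n \<Rightarrow> real^'m" where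
  "second_fundamental_form M f c x i j =
     partial_deriv i (partial_deriv j (local_rep c f)) x
     - (\<Sum>k\<in>UNIV. christoffel M c x k i j *\<^sub>R partial_deriv k (local_rep c f) x)"

definition unit_normals :: "('a \<Rightarrow> real^'m::finite) \<Rightarrow> ('a, 'n::finite) chart \<Rightarrow> real^'n \<Rightarrow> (real^'m) set" where
  "unit_normals f c x =
     {N. norm N = 1 \<and> (\<forall>u. N \<bullet> frechet_derivative (local_rep c f) (at x) u = 0)}"

text \<open>The matrix, in the coordinate frame, of the operator \<open>A\<close> with \<open>g(A u, v) = h(u, v) \<bullet> N\<close>.
  A hypersurface has exactly two unit normals \<open>N\<close> at each point; changing \<open>N\<close> to \<open>-N\<close>
  changes \<open>A\<close> to \<open>-A\<close>.\<close>

definition shape_operator ::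
    "('a, 'n::finite) riem \<Rightarrow> ('a \<Rightarrow> real^'m::finite) \<Rightarrow> ('a, 'n) chart \<Rightarrow> real^'n \<Rightarrow> real^'m \<Rightarrow> real^'n^'n" where
  "shape_operator M f c x N =
     matrix_inv (gram M c x) ** (\<chi> i j. second_fundamental_form M f c x i j \<bullet> N)"

definition principal_curvatures ::
    "('a, 'n::finite) riem \<Rightarrow> ('a \<Rightarrow> real^'m::finite) \<Rightarrow> ('a, 'n) chart \<Rightarrow> real^'n \<Rightarrow> real^'m \<Rightarrow> real set" where
  "principal_curvatures M f c x N =
     {\<kappa>. \<exists>v. v \<noteq> 0 \<and> shape_operator M f c x N *v v = \<kappa> *\<^sub>R v}"

definition mean_curvature ::
    "('a, 'n::finite) riem \<Rightarrow> ('a \<Rightarrow> real^'m::finite) \<Rightarrow> ('a, 'n) chart \<Rightarrow> real^'n \<Rightarrow> real^'m \<Rightarrow> real" where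
  "mean_curvature M f c x N = trace (shape_operator M f c x N) / real CARD('n)"

text \<open>From here on the ambient space is Euclidean 4-space.\<close>

definition hypersurface :: "('a, 3) riem \<Rightarrow> ('a \<Rightarrow> real^4) \<Rightarrow> bool" where
  "hypersurface M f \<longleftrightarrow> riemannian_manifold M \<and> isometric_immersion M f"

definition minimal_hypersurface :: "('a, 3) riem \<Rightarrow> ('a \<Rightarrow> real^4) \<Rightarrow> bool" where
  "minimal_hypersurface M f \<longleftrightarrow> hypersurface M f \<and>
     (\<forall>c\<in>atlas M. \<forall>x\<in>chart_image c. \<forall>N\<in>unit_normals f c x. trace (shape_operator M f c x N) = 0)"

definition ideal_hypersurface :: "('a, 3) riem \<Rightarrow> ('a \<Rightarrow> real^4) \<Rightarrow> bool" where
  "ideal_hypersurface M f \<longleftrightarrow> hypersurface M f \<and>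
     (\<forall>c\<in>atlas M. \<forall>x\<in>chart_image c. \<forall>N\<in>unit_normals f c x.
        delta M c x = 9/4 * (mean_curvature M f c x N)\<^sup>2)"

definition three_distinct_principal_curvatures :: "('a, 3) riem \<Rightarrow> ('a \<Rightarrow> real^4) \<Rightarrow> bool" where
  "three_distinct_principal_curvatures M f \<longleftrightarrow>
     (\<forall>c\<in>atlas M. \<forall>x\<in>chart_image c. \<forall>N\<in>unit_normals f c x.
        card (principal_curvatures M f c x N) = 3)"

end

theory Submission
  imports Defs
begin

text \<open>If \<open>S\<close> is a minimal surface in Euclidean 3-space, then \<open>S \<times> \<real>\<close> is a minimal hypersurface of Euclidean
  4-space with principal curvatures \<open>\<lambda>, -\<lambda>, 0\<close>. Its scalar curvature and the infimum of its sectional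
  curvatures both equal \<open>-\<lambda>\<^sup>2\<close>, so \<open>\<delta> = 0\<close> and the hypersurface is ideal. The helicoid and the universal
  cover of the catenoid have no flat points and are isometric: in suitable coordinates both carry
  the metric \<open>cosh\<^sup>2 u (du\<^sup>2 + dv\<^sup>2)\<close>. The catenoid is periodic in \<open>v\<close> while the helicoid is injective, so no
  isometry of the ambient space maps one immersion to the other.\<close>

section \<open>Calculus of smooth maps\<close>

lemma partial_deriv_eq:
  assumes "(f has_derivative D) (at x)"
  shows "partial_deriv i f x = D (axis i 1)"
  using frechet_derivative_at[OF assms] by (simp add: partial_deriv_def)

text \<open>Openness makes the derivative at a point of \<open>S\<close> depend only on values in
  \<open>S\<close>. A partial derivative can then be replaced by a formula known only on
  \<open>S\<close>, which the induction steps below rely on.\<close>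

lemma Ck_on_cong:
  assumes "open S" "\<And>x. x \<in> S \<Longrightarrow> f x = g x"
  shows "Ck_on k S f \<longleftrightarrow> Ck_on k S g"
  using assms(2)
proof (induction k arbitrary: f g)
  case 0
  then show ?case by (simp cong: continuous_on_cong)
next
  case (Suc k)
  have D: "(f has_derivative D) (at x) \<longleftrightarrow> (g has_derivative D) (at x)" if "x \<in> S" for x D
    using Suc.prems that assms(1) by (metis has_derivative_transform_within_open)
  \<comment> \<open>\<open>frechet_derivative\<close> chooses among all derivatives at the point, so
    equivalent predicates give the same choice, differentiable or not.\<close>
  have "Ck_on k S (partial_deriv i f) = Ck_on k S (partial_deriv i g)" for i
    by (rule Suc.IH) (simp add: partial_deriv_def frechet_derivative_def D)
  then show ?case by (simp add: differentiable_def D)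
qed

lemma Ck_on_SucD:
  assumes "Ck_on (Suc k) S f"
  shows "Ck_on k S f"
  using assms
proof (induction k arbitrary: f)
  case 0
  then show ?case
    by (simp add: differentiable_imp_continuous_within continuous_at_imp_continuous_on)
next
  case (Suc k)
  then show ?case by (metis Ck_on.simps(2))
qed

lemma Ck_on_const: "Ck_on k (S :: (real^'a::finite) set) (\<lambda>x. c)"
proof (induction k arbitrary: c)
  case (Suc k)
  have "partial_deriv i (\<lambda>x::real^'a. c) = (\<lambda>x. 0)" for i
    by (rule ext) (simp add: partial_deriv_eq[OF has_derivative_const])
  then show ?case by (simp add: Suc.IH)
qed simp

lemma Ck_on_bounded_linear:
  assumes "bounded_linear L"
  shows "Ck_on k S L"
proof (cases k)
  case (Suc m)
  have "partial_deriv i L = (\<lambda>x. L (axis i 1))" for i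
    by (rule ext) (rule partial_deriv_eq[OF bounded_linear_imp_has_derivative[OF assms]])
  with Suc show ?thesis
    by (simp add: Ck_on_const bounded_linear_imp_differentiable[OF assms])
qed (simp add: assms linear_continuous_on)

lemma Ck_on_add:
  assumes "open S" "Ck_on k S f" "Ck_on k S g"
  shows "Ck_on k S (\<lambda>x. f x + g x)"
  using assms(2,3)
proof (induction k arbitrary: f g)
  case 0
  then show ?case by (simp add: continuous_on_add)
next
  case (Suc k)
  have P: "partial_deriv i (\<lambda>x. f x + g x) x = partial_deriv i f x + partial_deriv i g x"
    if "x \<in> S" for x i
    using Suc.prems that
      partial_deriv_eq[OF has_derivative_add[of f "frechet_derivative f (at x)" "at x" g
        "frechet_derivative g (at x)"]]
    by (simp add: partial_deriv_def frechet_derivative_works)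
  have "Ck_on k S (partial_deriv i (\<lambda>x. f x + g x))" for i
    using Suc by (subst Ck_on_cong[OF assms(1) P]) auto
  with Suc.prems show ?case by simp
qed

text \<open>By the Leibniz rule a partial derivative is a sum of products with one differentiated
  factor; the other factor enters at order \<open>k\<close>, which \<open>Ck_on_SucD\<close>
  supplies. The bilinear form covers real products and scalar multiples at once.\<close>

lemma (in bounded_bilinear) Ck_on:
  assumes "open S" "Ck_on k S f" "Ck_on k S g"
  shows "Ck_on k S (\<lambda>x. prod (f x) (g x))"
  using assms(2,3)
proof (induction k arbitrary: f g)
  case 0
  then show ?case by (simp add: continuous_on)
next
  case (Suc k)
  have D: "((\<lambda>x. prod (f x) (g x)) has_derivative
      (\<lambda>h. prod (f x) (frechet_derivative g (at x) h) + prod (frechet_derivative f (at x) h) (g x)))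
      (at x)" if "x \<in> S" for x
    using Suc.prems that by (intro FDERIV) (auto simp flip: frechet_derivative_works)
  have P: "partial_deriv i (\<lambda>x. prod (f x) (g x)) x =
      prod (f x) (partial_deriv i g x) + prod (partial_deriv i f x) (g x)" if "x \<in> S" for x i
    using partial_deriv_eq[OF D[OF that]] by (simp add: partial_deriv_def)
  have "Ck_on k S (partial_deriv i (\<lambda>x. prod (f x) (g x)))" for i
    using Suc.prems Suc.prems[THEN Ck_on_SucD]
    by (subst Ck_on_cong[OF assms(1) P]) (auto intro!: Ck_on_add[OF assms(1)] Suc.IH)
  moreover have "(\<lambda>x. prod (f x) (g x)) differentiable (at x)" if "x \<in> S" for x
    using D[OF that] by (auto simp: differentiable_def)
  ultimately show ?case by simp
qed

text \<open>\<open>Ck_on\<close> speaks of functions on \<open>real^'n\<close>, so the outer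
  function is given by the sequence of its successive derivatives. The chain rule leads from
  \<open>G m\<close> to \<open>G (Suc m)\<close>, hence the induction treats all \<open>m\<close>
  together.\<close>

lemma Ck_on_compose_real:
  fixes f :: "real^'n \<Rightarrow> real" and G :: "nat \<Rightarrow> real \<Rightarrow> real"
  assumes "open S" "Ck_on k S f"
    and G: "\<And>m t. (G m has_real_derivative G (Suc m) t) (at t)"
  shows "Ck_on k S (\<lambda>x. G m (f x))"
  using assms(2)
proof (induction k arbitrary: m)
  case 0
  have "continuous_on UNIV (G m)"
    using G by (meson DERIV_isCont continuous_at_imp_continuous_on)
  with 0 show ?case
    by (metis Ck_on.simps(1) continuous_on_compose2 subset_UNIV)
next
  case (Suc k)
  have D: "((\<lambda>x. G m (f x)) has_derivative
      (\<lambda>h. frechet_derivative f (at x) h * G (Suc m) (f x))) (at x)" if "x \<in> S" for x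
    using Suc.prems that
    by (intro DERIV_compose_FDERIV G) (auto simp flip: frechet_derivative_works)
  have P: "partial_deriv i (\<lambda>x. G m (f x)) x = partial_deriv i f x * G (Suc m) (f x)"
    if "x \<in> S" for x i
    using partial_deriv_eq[OF D[OF that]] by (simp add: partial_deriv_def)
  have "Ck_on k S (partial_deriv i (\<lambda>x. G m (f x)))" for i
    using Suc.prems Ck_on_SucD[OF Suc.prems]
    by (subst Ck_on_cong[OF assms(1) P])
      (auto intro!: bounded_bilinear.Ck_on[OF bounded_bilinear_mult assms(1)] Suc.IH)
  moreover have "(\<lambda>x. G m (f x)) differentiable (at x)" if "x \<in> S" for x
    using D[OF that] by (auto simp: differentiable_def)
  ultimately show ?case by simp
qed

section \<open>Closure rules for smooth maps\<close>

lemma smooth_on_const: "smooth_on S (\<lambda>x. c)"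
  by (simp add: smooth_on_def Ck_on_const)

lemma smooth_on_ident: "smooth_on S (\<lambda>x. x)"
  by (simp add: smooth_on_def Ck_on_bounded_linear bounded_linear_ident)

lemma smooth_on_nth: "smooth_on S (\<lambda>x. x $ i)"
  by (simp add: smooth_on_def Ck_on_bounded_linear bounded_linear_vec_nth)

lemma smooth_on_add:
  "\<lbrakk>open S; smooth_on S f; smooth_on S g\<rbrakk> \<Longrightarrow> smooth_on S (\<lambda>x. f x + g x)"
  by (simp add: smooth_on_def Ck_on_add)

lemma smooth_on_mult:
  fixes f g :: "real^'n \<Rightarrow> real"
  shows "\<lbrakk>open S; smooth_on S f; smooth_on S g\<rbrakk> \<Longrightarrow> smooth_on S (\<lambda>x. f x * g x)"
  by (simp add: smooth_on_def bounded_bilinear.Ck_on[OF bounded_bilinear_mult])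

lemma smooth_on_scaleR:
  fixes f :: "real^'n \<Rightarrow> real"
  shows "\<lbrakk>open S; smooth_on S f; smooth_on S g\<rbrakk> \<Longrightarrow> smooth_on S (\<lambda>x. f x *\<^sub>R g x)"
  by (simp add: smooth_on_def bounded_bilinear.Ck_on[OF bounded_bilinear_scaleR])

lemma smooth_on_sinh_cosh:
  fixes f :: "real^'n \<Rightarrow> real"
  assumes "open S" "smooth_on S f"
  shows "smooth_on S (\<lambda>x. sinh (f x))" "smooth_on S (\<lambda>x. cosh (f x))"
proof -
  \<comment> \<open>Differentiation alternates between the two functions, so members 0 and 1 of one
    sequence give both claims.\<close>
  define G :: "nat \<Rightarrow> real \<Rightarrow> real" where "G m = (if even m then sinh else cosh)" for m
  have "(G m has_real_derivative G (Suc m) t) (at t)" for m t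
    by (auto simp: G_def intro!: derivative_eq_intros)
  then have "smooth_on S (\<lambda>x. G m (f x))" for m
    using assms by (auto simp: smooth_on_def intro: Ck_on_compose_real)
  from this[of 0] this[of 1] show "smooth_on S (\<lambda>x. sinh (f x))" "smooth_on S (\<lambda>x. cosh (f x))"
    by (simp_all add: G_def)
qed

lemma smooth_on_sin_cos:
  fixes f :: "real^'n \<Rightarrow> real"
  assumes "open S" "smooth_on S f"
  shows "smooth_on S (\<lambda>x. sin (f x))" "smooth_on S (\<lambda>x. cos (f x))"
proof -
  \<comment> \<open>Differentiating the sine shifts its argument by pi / 2; member 1 is the
    cosine.\<close>
  define G :: "nat \<Rightarrow> real \<Rightarrow> real" where "G m t = sin (t + real m * (pi / 2))" for m t
  have "(G m has_real_derivative G (Suc m) t) (at t)" for m t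
    unfolding G_def
    by (rule derivative_eq_intros refl)+ (simp add: sin_add cos_add algebra_simps add_divide_distrib)
  then have "smooth_on S (\<lambda>x. G m (f x))" for m
    using assms by (auto simp: smooth_on_def intro: Ck_on_compose_real)
  from this[of 0] this[of 1] show "smooth_on S (\<lambda>x. sin (f x))" "smooth_on S (\<lambda>x. cos (f x))"
    by (simp_all add: G_def sin_add)
qed

lemmas smooth_intros = smooth_on_const smooth_on_nth smooth_on_add smooth_on_mult smooth_on_scaleR
  smooth_on_sinh_cosh smooth_on_sin_cos

lemmas has_derivative_vec_nth [derivative_intros] =
  bounded_linear.has_derivative[OF bounded_linear_vec_nth]

lemma has_derivative_sinh_compose [derivative_intros]:
  fixes f :: "'a::real_normed_vector \<Rightarrow> real"
  assumes "(f has_derivative f') (at x within S)"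
  shows "((\<lambda>x. sinh (f x)) has_derivative (\<lambda>h. f' h * cosh (f x))) (at x within S)"
  by (rule DERIV_compose_FDERIV[OF _ assms]) (auto intro!: derivative_eq_intros)

lemma has_derivative_cosh_compose [derivative_intros]:
  fixes f :: "'a::real_normed_vector \<Rightarrow> real"
  assumes "(f has_derivative f') (at x within S)"
  shows "((\<lambda>x. cosh (f x)) has_derivative (\<lambda>h. f' h * sinh (f x))) (at x within S)"
  by (rule DERIV_compose_FDERIV[OF _ assms]) (auto intro!: derivative_eq_intros)

lemma matrix_inv_eq:
  fixes A B :: "real^'n^'n"
  assumes "A ** B = mat 1"
  shows "matrix_inv A = B"
  unfolding matrix_inv_def
proof (rule some_equality)
  show "A ** B = mat 1 \<and> B ** A = mat 1"
    using assms by (simp add: matrix_left_right_inverse)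
  fix B' assume "A ** B' = mat 1 \<and> B' ** A = mat 1"
  with assms show "B' = B"
    by (metis matrix_mul_assoc matrix_mul_lid matrix_mul_rid)
qed

section \<open>Euclidean space with a global metric tensor\<close>

text \<open>One identity chart suffices because both surfaces are parametrised by the entire plane;
  overlap conditions reduce to the identity transition.\<close>

definition coordinate_space :: "(real^'n \<Rightarrow> real^'n^'n) \<Rightarrow> (real^'n, 'n::finite) riem" where
  "coordinate_space G = \<lparr>space_of = euclidean, atlas = {(UNIV, id)}, metric = (\<lambda>c. G)\<rparr>"

lemma chart_id [simp]: "chart_image (UNIV, id) = UNIV" "chart_inv (UNIV, id) = id"
  by (auto simp: chart_image_def chart_inv_def inv_into_def fun_eq_iff)

lemma coordinate_space_simps [simp]:
  "space_of (coordinate_space G) = euclidean"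
  "atlas (coordinate_space G) = {(UNIV, id)}"
  "gram (coordinate_space G) (UNIV, id) = G"
  by (auto simp: coordinate_space_def gram_def fun_eq_iff)

lemma local_rep_id [simp]: "local_rep (UNIV, id) f = f"
  by (simp add: local_rep_def)

lemma riemannian_manifold_coordinate_space:
  fixes G :: "real^'n \<Rightarrow> real^'n::finite^'n"
  assumes "smooth_on UNIV G" "\<And>x. transpose (G x) = G x"
    and "\<And>x v. v \<noteq> 0 \<Longrightarrow> v \<bullet> (G x *v v) > 0"
  shows "riemannian_manifold (coordinate_space G)"
proof -
  have tr: "transition (UNIV, id) (UNIV, id) = (\<lambda>x::real^'n. x)"
    by (auto simp: transition_def)
  have chart: "chart_on euclidean (UNIV, id :: real^'n \<Rightarrow> real^'n)"
    by (simp add: chart_on_def homeomorphic_map_id)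
  obtain \<B> :: "(real^'n) set set" where "countable \<B>" "topological_basis \<B>"
    using ex_countable_basis by blast
  then have "open = arbitrary union_of (\<lambda>U. U \<in> \<B>)"
    by (auto simp: fun_eq_iff union_of_def arbitrary_def topological_basis_def subset_eq)
  moreover have "openin euclidean = (open :: (real^'n) set \<Rightarrow> bool)"
    by (auto simp: fun_eq_iff)
  ultimately show ?thesis
    unfolding riemannian_manifold_def
    using assms chart \<open>countable \<B>\<close>
    by (auto simp: smooth_atlas_def tr smooth_on_ident ginner_def jacobian_def
      connected_space_subconnected Hausdorff_space_euclidean
      matrix_id_mat_1[unfolded id_def] transpose_mat)
qed

lemma isometric_immersion_coordinate_space:
  assumes "smooth_on UNIV f"
    and D: "\<And>x. (f has_derivative f' x) (at x)"
    and f': "\<And>x u v. f' x u \<bullet> f' x v = u \<bullet> (G x *v v)"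
    and pos: "\<And>x v. v \<noteq> 0 \<Longrightarrow> v \<bullet> (G x *v v) > 0"
  shows "isometric_immersion (coordinate_space G) f"
proof -
  \<comment> \<open>A vector in the kernel of \<open>f' x\<close> has length zero in the metric, so
    positivity makes it vanish.\<close>
  have "inj (f' x)" for x
  proof (rule injI)
    fix u v assume "f' x u = f' x v"
    then have "f' x (u - v) = 0"
      using has_derivative_linear[OF D] by (simp add: linear_diff)
    then show "u = v"
      using f'[of x "u - v" "u - v"] pos[of "u - v" x] by force
  qed
  moreover have "frechet_derivative f (at x) = f' x" for x
    using frechet_derivative_at[OF D] by simp
  ultimately show ?thesis
    using assms by (simp add: isometric_immersion_def ginner_def)
qed

section \<open>The catenoid metric\<close>

text \<open>The product metric cosh^2 u (du^2 + dv^2) + dt^2. Its form as a scaled constant matrix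
  plus a constant one lets the closure rules prove smoothness.\<close>

definition cat_gram :: "real^3 \<Rightarrow> real^3^3" where
  "cat_gram x = (cosh (x $ 1) * cosh (x $ 1)) *\<^sub>R (\<chi> i j. if i = j \<and> i \<noteq> 3 then 1 else 0)
     + (\<chi> i j. if i = 3 \<and> j = 3 then 1 else 0)"

abbreviation cat_space :: "(real^3, 3) riem" where
  "cat_space \<equiv> coordinate_space cat_gram"

lemma cat_gram_nth:
  "cat_gram x $ i $ j = (if i = j then if i = 3 then 1 else (cosh (x $ 1))\<^sup>2 else 0)"
  by (simp add: cat_gram_def power2_eq_square)

lemma cat_gram_inner:
  "u \<bullet> (cat_gram x *v v) = (cosh (x $ 1))\<^sup>2 * (u $ 1 * v $ 1 + u $ 2 * v $ 2) + u $ 3 * v $ 3"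
  by (simp add: inner_vec_def matrix_vector_mult_def cat_gram_nth sum_3 algebra_simps)

lemma smooth_cat_gram: "smooth_on UNIV cat_gram"
  unfolding cat_gram_def[abs_def] by (intro smooth_intros open_UNIV)

lemma transpose_cat_gram: "transpose (cat_gram x) = cat_gram x"
  by (simp add: vec_eq_iff transpose_def cat_gram_nth)

lemma cat_gram_pos: "v \<noteq> 0 \<Longrightarrow> v \<bullet> (cat_gram x *v v) > 0"
proof -
  assume "v \<noteq> 0"
  then consider "v $ 1 \<noteq> 0" | "v $ 2 \<noteq> 0" | "v $ 3 \<noteq> 0"
    by (auto simp: vec_eq_iff forall_3)
  then have "(v $ 1)\<^sup>2 + (v $ 2)\<^sup>2 + (v $ 3)\<^sup>2 > 0"
    by cases (simp_all add: add_pos_nonneg add_nonneg_pos)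
  \<comment> \<open>As cosh is at least 1, the metric dominates the Euclidean one.\<close>
  also have "\<dots> \<le> (cosh (x $ 1))\<^sup>2 * ((v $ 1)\<^sup>2 + (v $ 2)\<^sup>2) + (v $ 3)\<^sup>2"
    using mult_right_mono[of 1 "(cosh (x $ 1))\<^sup>2" "(v $ 1)\<^sup>2 + (v $ 2)\<^sup>2"]
    by (simp add: cosh_real_ge_1)
  finally show ?thesis
    by (simp add: cat_gram_inner power2_eq_square)
qed

lemma riemannian_cat_space: "riemannian_manifold cat_space"
  by (intro riemannian_manifold_coordinate_space smooth_cat_gram transpose_cat_gram cat_gram_pos)

section \<open>Connection and curvature of the metric\<close>

lemma matrix_inv_cat_gram:
  "matrix_inv (cat_gram x) =
    (\<chi> i j. if i = j then if i = 3 then 1 else 1 / (cosh (x $ 1))\<^sup>2 else 0)" (is "_ = ?B")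
proof (rule matrix_inv_eq)
  show "cat_gram x ** ?B = mat 1"
    by (simp add: vec_eq_iff matrix_matrix_mult_def mat_def forall_3 sum_3 cat_gram_nth)
qed

lemma partial_cat_gram:
  "partial_deriv k (\<lambda>y. cat_gram y $ i $ j) x =
     (if k = 1 \<and> i = j \<and> i \<noteq> 3 then 2 * cosh (x $ 1) * sinh (x $ 1) else 0)"
proof -
  have "((\<lambda>y. cat_gram y $ i $ j) has_derivative
     (\<lambda>h. if i = j \<and> i \<noteq> 3 then 2 * cosh (x $ 1) * sinh (x $ 1) * h $ 1 else 0)) (at x)"
    unfolding cat_gram_nth
    by (cases "i = j"; cases "i = 3") (auto simp: fun_eq_iff intro!: derivative_eq_intros)
  from partial_deriv_eq[OF this] show ?thesis
    by (auto simp: axis_def)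
qed

text \<open>On the (u, v) plane the metric is exp (2 phi) times the flat one, with phi = ln (cosh
  u). Up to sign the nonzero symbols are phi' = tanh u; the line factor contributes none.\<close>

lemma christoffel_cat:
  "christoffel cat_space (UNIV, id) x k i j =
     (if (k, i, j) \<in> {(1, 1, 1), (2, 1, 2), (2, 2, 1)} then tanh (x $ 1)
      else if (k, i, j) = (1, 2, 2) then - tanh (x $ 1) else 0)"
  unfolding christoffel_def coordinate_space_simps partial_cat_gram matrix_inv_cat_gram
  using exhaust_3[of k] exhaust_3[of i] exhaust_3[of j]
  by (elim disjE) (simp_all add: sum_3 tanh_def power2_eq_square)

text \<open>Components of the flat area form of the (u, v) plane, extended by zero to the line
  factor. It encodes the antisymmetries of the curvature tensor.\<close>

definition eps :: "3 \<Rightarrow> 3 \<Rightarrow> real" where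
  "eps i j = (if i = 1 \<and> j = 2 then 1 else if i = 2 \<and> j = 1 then - 1 else 0)"

lemma partial_christoffel_cat:
  "partial_deriv m (\<lambda>y. christoffel cat_space (UNIV, id) y k i j) x =
     (if m \<noteq> 1 then 0
      else if (k, i, j) \<in> {(1, 1, 1), (2, 1, 2), (2, 2, 1)} then 1 / (cosh (x $ 1))\<^sup>2
      else if (k, i, j) = (1, 2, 2) then - 1 / (cosh (x $ 1))\<^sup>2 else 0)"
proof -
  have "((\<lambda>y. tanh (y $ 1)) has_derivative (\<lambda>h. h $ 1 / (cosh (x $ 1))\<^sup>2)) (at x)" for x :: "real^3"
    by (auto simp: fun_eq_iff tanh_def field_simps power2_eq_square
      cosh_square_eq[unfolded power2_eq_square] intro!: derivative_eq_intros)
  note T = this has_derivative_minus[OF this]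
  have P: "partial_deriv m (\<lambda>y. tanh (y $ 1)) x = (if m = 1 then 1 / (cosh (x $ 1))\<^sup>2 else 0)"
    "partial_deriv m (\<lambda>y. - tanh (y $ 1)) x = (if m = 1 then - 1 / (cosh (x $ 1))\<^sup>2 else 0)"
    "partial_deriv m (\<lambda>y. 0 :: real) x = 0"
    using partial_deriv_eq[OF T(1)] partial_deriv_eq[OF T(2)]
      partial_deriv_eq[OF has_derivative_const[of "0::real" "at x"]]
    by (simp_all add: axis_def)
  show ?thesis
  \<comment> \<open>The case conditions do not depend on the point; deciding them first leaves tanh,
    - tanh or 0 under the derivative.\<close>
  proof (cases "(k, i, j) \<in> {(1, 1, 1), (2, 1, 2), (2, 2, 1)}")
    case True
    show ?thesis
      unfolding christoffel_cat if_P[OF True] P by simp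
  next
    case False
    show ?thesis
    proof (cases "(k, i, j) = (1, 2, 2)")
      case True
      show ?thesis
        unfolding christoffel_cat if_not_P[OF False] if_P[OF True] P by simp
    next
      case F: False
      show ?thesis
        unfolding christoffel_cat if_not_P[OF False] if_not_P[OF F] P by simp
    qed
  qed
qed

text \<open>The surface has Gauss curvature K = - 1 / cosh^4 u and the line is flat. The tensor is K
  times that of constant curvature 1 on the (u, v) plane, which carries one metric factor cosh^2
  u.\<close>

lemma riem_coeff_cat:
  "riem_coeff cat_space (UNIV, id) x l i j k = - (eps l k * eps i j) / (cosh (x $ 1))\<^sup>2"
  unfolding riem_coeff_def partial_christoffel_cat
  unfolding christoffel_cat sum_3
  using exhaust_3[of l] exhaust_3[of i] exhaust_3[of j] exhaust_3[of k]
  by (elim disjE) (simp_all add: eps_def)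

lemma curvature_cat:
  "ginner cat_space (UNIV, id) x (curvature_op cat_space (UNIV, id) x u v v) u =
     - (u $ 1 * v $ 2 - u $ 2 * v $ 1)\<^sup>2"
  unfolding ginner_def coordinate_space_simps cat_gram_inner curvature_op_def riem_coeff_cat
  by (simp add: sum_3 eps_def field_simps power2_eq_square)

text \<open>As in Lagrange's identity, the Gram determinant becomes a weighted sum of squared 2 by 2
  minors, which isolates the minor of the surface plane.\<close>

lemma sectional_cat:
  "sectional cat_space (UNIV, id) x u v =
    - (u $ 1 * v $ 2 - u $ 2 * v $ 1)\<^sup>2 /
      ((cosh (x $ 1))^4 * (u $ 1 * v $ 2 - u $ 2 * v $ 1)\<^sup>2 +
       (cosh (x $ 1))\<^sup>2 * ((u $ 1 * v $ 3 - u $ 3 * v $ 1)\<^sup>2 + (u $ 2 * v $ 3 - u $ 3 * v $ 2)\<^sup>2))"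
  unfolding sectional_def curvature_cat
  unfolding ginner_def coordinate_space_simps cat_gram_inner
  by (rule arg_cong2[where f = "(/)"]) (rule refl, algebra)

text \<open>The minimum is attained on the plane tangent to the surface. Minors involving the line
  direction enlarge the denominator and move the negative value towards zero.\<close>

lemma inf_K_cat: "inf_K cat_space (UNIV, id) x = - 1 / (cosh (x $ 1))^4"
  unfolding inf_K_def
proof (rule cInf_eq_minimum)
  have "axis 1 1 \<noteq> (axis 2 1 :: real^3)"
    by (simp add: axis_eq_axis)
  moreover from this have "independent {axis 1 1, axis 2 1 :: real^3}"
    by (intro independent_mono[OF independent_Basis]) auto
  moreover have "sectional cat_space (UNIV, id) x (axis 1 1) (axis 2 1) = - 1 / (cosh (x $ 1))^4"
    by (simp add: sectional_cat axis_def)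
  ultimately show "- 1 / (cosh (x $ 1))^4 \<in>
      {sectional cat_space (UNIV, id) x u v |u v. u \<noteq> v \<and> independent {u, v}}"
    by (metis (mono_tags, lifting) mem_Collect_eq)
next
  \<comment> \<open>\<open>P\<close> is the squared minor of the surface plane and \<open>Q\<close>
    collects the other two. Dropping \<open>Q\<close> enlarges the quotient; \<open>P\<close> can be
    cancelled only when nonzero, and otherwise the quotient is 0.\<close>
  have "P / (C^4 * P + C\<^sup>2 * Q) \<le> 1 / C^4" if "P \<ge> 0" "Q \<ge> 0" "C > 0" for P Q C :: real
  proof (cases "P = 0")
    case False
    then have "P / (C^4 * P + C\<^sup>2 * Q) \<le> P / (C^4 * P)"
      using that by (intro divide_left_mono) (auto intro!: mult_pos_pos add_pos_nonneg)
    with False show ?thesis by simp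
  qed (use that in simp)
  from this[of "(u $ 1 * v $ 2 - u $ 2 * v $ 1)\<^sup>2"
      "(u $ 1 * v $ 3 - u $ 3 * v $ 1)\<^sup>2 + (u $ 2 * v $ 3 - u $ 3 * v $ 2)\<^sup>2" "cosh (x $ 1)" for u v]
  show "- 1 / (cosh (x $ 1))^4 \<le> y"
    if "y \<in> {sectional cat_space (UNIV, id) x u v |u v. u \<noteq> v \<and> independent {u, v}}" for y
    using that by (auto simp: sectional_cat)
qed

text \<open>\<open>scalar_curvature\<close> is a description over all orthonormal frames, so the sum
  is needed for each of them. Orthonormality of the frame makes the coordinate rows \<open>a\<close>
  and \<open>b\<close> orthogonal with squared length 1 / cosh^2 u, and the sum is minus the squared
  length of their cross product.\<close>

lemma orthonormal_frame_cat:
  assumes "orthonormal_frame cat_space (UNIV, id) x e"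
  shows "(\<Sum>(i, j)\<in>{(i, j). i < j}. sectional cat_space (UNIV, id) x (e i) (e j)) =
    - 1 / (cosh (x $ 1))^4"
proof -
  define B :: "real^3^3" where "B = (\<chi> k i. e i $ k)"
  have e: "e i \<bullet> (cat_gram x *v e j) = (if i = j then 1 else 0)" for i j
    using assms by (simp add: orthonormal_frame_def ginner_def)
  have "(transpose B ** cat_gram x) ** B = mat 1"
    using e by (simp add: vec_eq_iff B_def transpose_def matrix_matrix_mult_def mat_def sum_3
        cat_gram_nth cat_gram_inner algebra_simps)
  \<comment> \<open>A one-sided inverse is two-sided, so \<open>B ** transpose B\<close> is the
    inverse metric; its entries are the inner products of the rows of \<open>B\<close>.\<close>
  then have "B ** (transpose B ** cat_gram x) = mat 1"
    by (simp add: matrix_left_right_inverse)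
  then have *: "(B ** (transpose B ** cat_gram x)) $ k $ l = (if k = l then 1 else 0)" for k l
    by (simp add: mat_def)
  define a b where "a i = e i $ 1" and "b i = e i $ 2" for i
  define E where "E = (cosh (x $ 1))\<^sup>2"
  have "E > 0" by (simp add: E_def)
  have "E * ((a 1)\<^sup>2 + (a 2)\<^sup>2 + (a 3)\<^sup>2) = 1" "E * ((b 1)\<^sup>2 + (b 2)\<^sup>2 + (b 3)\<^sup>2) = 1"
    "E * (a 1 * b 1 + a 2 * b 2 + a 3 * b 3) = 0"
    using *[of 1 1] *[of 2 2] *[of 1 2]
    by (simp_all add: B_def transpose_def matrix_matrix_mult_def sum_3 cat_gram_nth a_def b_def
      E_def algebra_simps power2_eq_square)
  moreover have "X = y / E" if "E * X = y" for X y
    using that \<open>E > 0\<close> by auto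
  ultimately have ab: "(a 1)\<^sup>2 + (a 2)\<^sup>2 + (a 3)\<^sup>2 = 1 / E" "(b 1)\<^sup>2 + (b 2)\<^sup>2 + (b 3)\<^sup>2 = 1 / E"
    "a 1 * b 1 + a 2 * b 2 + a 3 * b 3 = 0 / E"
    by blast+
  have sec: "sectional cat_space (UNIV, id) x (e i) (e j) = - (a i * b j - b i * a j)\<^sup>2"
    if "i \<noteq> j" for i j
    using that e unfolding sectional_def curvature_cat by (simp add: ginner_def a_def b_def)
  \<comment> \<open>The numeral 3 of type \<open>3\<close> denotes 0, so it is the least element.\<close>
  have "{(i, j). i < j} = {(3, 1), (3, 2), (1, 2 :: 3)}"
    by (auto simp: set_eq_iff forall_3 less_bit1_def bit1.Rep_numeral bit1.Rep_1)
  then have "(\<Sum>(i, j)\<in>{(i, j). i < j}. sectional cat_space (UNIV, id) x (e i) (e j)) =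
      - ((a 3 * b 1 - b 3 * a 1)\<^sup>2 + (a 3 * b 2 - b 3 * a 2)\<^sup>2 + (a 1 * b 2 - b 1 * a 2)\<^sup>2)"
    by (simp add: sec)
  \<comment> \<open>Lagrange's identity for \<open>a\<close> and \<open>b\<close>.\<close>
  also have "\<dots> = - (((a 1)\<^sup>2 + (a 2)\<^sup>2 + (a 3)\<^sup>2) * ((b 1)\<^sup>2 + (b 2)\<^sup>2 + (b 3)\<^sup>2)
      - (a 1 * b 1 + a 2 * b 2 + a 3 * b 3)\<^sup>2)"
    by algebra
  also have "\<dots> = - 1 / (cosh (x $ 1))^4"
    by (simp add: ab E_def flip: power_mult)
  finally show ?thesis .
qed

lemma scalar_curvature_cat: "scalar_curvature cat_space (UNIV, id) x = - 1 / (cosh (x $ 1))^4"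
proof -
  \<comment> \<open>An explicit frame is what makes the description unique: if there were no frame,
    every \<open>t\<close> would satisfy it.\<close>
  define e :: "3 \<Rightarrow> real^3" where "e i = axis i (if i = 3 then 1 else 1 / cosh (x $ 1))" for i
  have "orthonormal_frame cat_space (UNIV, id) x e"
    by (simp add: orthonormal_frame_def ginner_def cat_gram_inner forall_3 e_def axis_def power2_eq_square)
  then show ?thesis
    unfolding scalar_curvature_def by (intro the_equality) (auto simp: orthonormal_frame_cat)
qed

lemma delta_cat: "delta cat_space (UNIV, id) x = 0"
  by (simp add: delta_def scalar_curvature_cat inf_K_cat)

section \<open>Helicoid and catenoid\<close>

definition helicoid :: "real^3 \<Rightarrow> real^4" where
  "helicoid x = (sinh (x $ 1) * cos (x $ 2)) *\<^sub>R axis 1 1 + (sinh (x $ 1) * sin (x $ 2)) *\<^sub>R axis 2 1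
     + (x $ 2) *\<^sub>R axis 3 1 + (x $ 3) *\<^sub>R axis 4 1"

definition catenoid :: "real^3 \<Rightarrow> real^4" where
  "catenoid x = (cosh (x $ 1) * cos (x $ 2)) *\<^sub>R axis 1 1 + (cosh (x $ 1) * sin (x $ 2)) *\<^sub>R axis 2 1
     + (x $ 1) *\<^sub>R axis 3 1 + (x $ 3) *\<^sub>R axis 4 1"

lemma helicoid_deriv:
  "(helicoid has_derivative (\<lambda>h.
     (h $ 1 * cosh (x $ 1) * cos (x $ 2) - h $ 2 * sinh (x $ 1) * sin (x $ 2)) *\<^sub>R axis 1 1
     + (h $ 1 * cosh (x $ 1) * sin (x $ 2) + h $ 2 * sinh (x $ 1) * cos (x $ 2)) *\<^sub>R axis 2 1
     + (h $ 2) *\<^sub>R axis 3 1 + (h $ 3) *\<^sub>R axis 4 1)) (at x)"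
  unfolding helicoid_def[abs_def]
  by (rule derivative_eq_intros refl)+ (simp add: fun_eq_iff algebra_simps)

lemma catenoid_deriv:
  "(catenoid has_derivative (\<lambda>h.
     (h $ 1 * sinh (x $ 1) * cos (x $ 2) - h $ 2 * cosh (x $ 1) * sin (x $ 2)) *\<^sub>R axis 1 1
     + (h $ 1 * sinh (x $ 1) * sin (x $ 2) + h $ 2 * cosh (x $ 1) * cos (x $ 2)) *\<^sub>R axis 2 1
     + (h $ 1) *\<^sub>R axis 3 1 + (h $ 3) *\<^sub>R axis 4 1)) (at x)"
  unfolding catenoid_def[abs_def]
  by (rule derivative_eq_intros refl)+ (simp add: fun_eq_iff algebra_simps)

lemma isometric_helicoid: "isometric_immersion cat_space helicoid"
proof (rule isometric_immersion_coordinate_space[OF _ helicoid_deriv _ cat_gram_pos])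
  show "smooth_on UNIV helicoid"
    unfolding helicoid_def[abs_def] by (intro smooth_intros open_UNIV)
next
  fix x u v :: "real^3"
  \<comment> \<open>Once the inner products are expanded, the claim is a polynomial identity modulo
    these two relations.\<close>
  have *: "(sin (x $ 2))\<^sup>2 + (cos (x $ 2))\<^sup>2 = 1" "(cosh (x $ 1))\<^sup>2 = (sinh (x $ 1))\<^sup>2 + 1"
    using cosh_square_eq[of "x $ 1"] by simp_all
  show "((u $ 1 * cosh (x $ 1) * cos (x $ 2) - u $ 2 * sinh (x $ 1) * sin (x $ 2)) *\<^sub>R axis 1 1
     + (u $ 1 * cosh (x $ 1) * sin (x $ 2) + u $ 2 * sinh (x $ 1) * cos (x $ 2)) *\<^sub>R axis 2 1
     + (u $ 2) *\<^sub>R axis 3 1 + (u $ 3) *\<^sub>R axis 4 1) \<bullet>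
    ((v $ 1 * cosh (x $ 1) * cos (x $ 2) - v $ 2 * sinh (x $ 1) * sin (x $ 2)) *\<^sub>R axis 1 1
     + (v $ 1 * cosh (x $ 1) * sin (x $ 2) + v $ 2 * sinh (x $ 1) * cos (x $ 2)) *\<^sub>R axis 2 1
     + (v $ 2) *\<^sub>R axis 3 1 + (v $ 3) *\<^sub>R axis 4 (1::real) :: real^4) = u \<bullet> (cat_gram x *v v)"
    unfolding cat_gram_inner inner_add_left inner_add_right inner_scaleR_left inner_scaleR_right
      inner_axis_axis
    by (simp, insert *, algebra)
qed

text \<open>The third coordinate now completes sinh^2 to cosh^2 in the u direction, where for the
  helicoid it does so in the v direction.\<close>

lemma isometric_catenoid: "isometric_immersion cat_space catenoid"
proof (rule isometric_immersion_coordinate_space[OF _ catenoid_deriv _ cat_gram_pos])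
  show "smooth_on UNIV catenoid"
    unfolding catenoid_def[abs_def] by (intro smooth_intros open_UNIV)
next
  fix x u v :: "real^3"
  have *: "(sin (x $ 2))\<^sup>2 + (cos (x $ 2))\<^sup>2 = 1" "(cosh (x $ 1))\<^sup>2 = (sinh (x $ 1))\<^sup>2 + 1"
    using cosh_square_eq[of "x $ 1"] by simp_all
  show "((u $ 1 * sinh (x $ 1) * cos (x $ 2) - u $ 2 * cosh (x $ 1) * sin (x $ 2)) *\<^sub>R axis 1 1
     + (u $ 1 * sinh (x $ 1) * sin (x $ 2) + u $ 2 * cosh (x $ 1) * cos (x $ 2)) *\<^sub>R axis 2 1
     + (u $ 1) *\<^sub>R axis 3 1 + (u $ 3) *\<^sub>R axis 4 1) \<bullet>
    ((v $ 1 * sinh (x $ 1) * cos (x $ 2) - v $ 2 * cosh (x $ 1) * sin (x $ 2)) *\<^sub>R axis 1 1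
     + (v $ 1 * sinh (x $ 1) * sin (x $ 2) + v $ 2 * cosh (x $ 1) * cos (x $ 2)) *\<^sub>R axis 2 1
     + (v $ 1) *\<^sub>R axis 3 1 + (v $ 3) *\<^sub>R axis 4 (1::real) :: real^4) = u \<bullet> (cat_gram x *v v)"
    unfolding cat_gram_inner inner_add_left inner_add_right inner_scaleR_left inner_scaleR_right
      inner_axis_axis
    by (simp, insert *, algebra)
qed

lemma not_rigid_helicoid: "\<not> rigid cat_space helicoid"
proof
  assume "rigid cat_space helicoid"
  then obtain \<Phi> where \<Phi>: "euclidean_isometry \<Phi>" "\<And>p. catenoid p = \<Phi> (helicoid p)"
    using isometric_catenoid unfolding rigid_def by auto
  \<comment> \<open>One full turn in v: the catenoid closes up while the helicoid climbs by 2 pi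
    along its axis.\<close>
  let ?p = "(2 * pi) *\<^sub>R axis 2 1 :: real^3"
  have "catenoid ?p = catenoid 0"
    by (simp add: catenoid_def axis_def)
  with \<Phi> have "helicoid ?p = helicoid 0"
    by (metis bij_is_inj euclidean_isometry_def injD)
  then have "helicoid ?p $ 3 = helicoid 0 $ 3" by simp
  then show False
    by (simp add: helicoid_def axis_def)
qed

section \<open>Second fundamental form and principal curvatures of the helicoid\<close>

lemma helicoid_partials:
  "partial_deriv 1 helicoid = (\<lambda>x. (cosh (x $ 1) * cos (x $ 2)) *\<^sub>R axis 1 1
     + (cosh (x $ 1) * sin (x $ 2)) *\<^sub>R axis 2 1)"
  "partial_deriv 2 helicoid = (\<lambda>x. (- sinh (x $ 1) * sin (x $ 2)) *\<^sub>R axis 1 1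
     + (sinh (x $ 1) * cos (x $ 2)) *\<^sub>R axis 2 1 + axis 3 1)"
  "partial_deriv 3 helicoid = (\<lambda>x. axis 4 1)"
  \<comment> \<open>Only axes of the domain \<open>real^3\<close> are unfolded; the basis vectors of
    \<open>real^4\<close> stay intact.\<close>
  by (rule ext, simp add: partial_deriv_eq[OF helicoid_deriv] axis_def[of _ "1::real", where 'b=3])+

lemma helicoid_partials2:
  "partial_deriv i (partial_deriv 1 helicoid) x =
    (if i = 1 then (sinh (x $ 1) * cos (x $ 2)) *\<^sub>R axis 1 1 + (sinh (x $ 1) * sin (x $ 2)) *\<^sub>R axis 2 1
     else if i = 2 then - (cosh (x $ 1) * sin (x $ 2)) *\<^sub>R axis 1 1 + (cosh (x $ 1) * cos (x $ 2)) *\<^sub>R axis 2 1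
     else 0)" (is ?A)
  "partial_deriv i (partial_deriv 2 helicoid) x =
    (if i = 1 then - (cosh (x $ 1) * sin (x $ 2)) *\<^sub>R axis 1 1 + (cosh (x $ 1) * cos (x $ 2)) *\<^sub>R axis 2 1
     else if i = 2 then - (sinh (x $ 1) * cos (x $ 2)) *\<^sub>R axis 1 1 - (sinh (x $ 1) * sin (x $ 2)) *\<^sub>R axis 2 1
     else 0)" (is ?B)
  "partial_deriv i (partial_deriv 3 helicoid) x = 0" (is ?C)
proof -
  have i: "i = 1 \<or> i = 2 \<or> i = 3" by (rule exhaust_3)
  have "(partial_deriv 1 helicoid has_derivative (\<lambda>h.
      (h $ 1 * sinh (x $ 1) * cos (x $ 2) - h $ 2 * cosh (x $ 1) * sin (x $ 2)) *\<^sub>R axis 1 1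
      + (h $ 1 * sinh (x $ 1) * sin (x $ 2) + h $ 2 * cosh (x $ 1) * cos (x $ 2)) *\<^sub>R axis 2 1)) (at x)"
    unfolding helicoid_partials
    by (rule derivative_eq_intros refl)+ (simp add: fun_eq_iff algebra_simps)
  from partial_deriv_eq[OF this, of i] i show ?A by (auto simp: axis_def[where 'b=3])
  have "(partial_deriv 2 helicoid has_derivative (\<lambda>h.
      (- h $ 1 * cosh (x $ 1) * sin (x $ 2) - h $ 2 * sinh (x $ 1) * cos (x $ 2)) *\<^sub>R axis 1 1
      + (h $ 1 * cosh (x $ 1) * cos (x $ 2) - h $ 2 * sinh (x $ 1) * sin (x $ 2)) *\<^sub>R axis 2 1)) (at x)"
    unfolding helicoid_partials
    by (rule derivative_eq_intros refl)+ (simp add: fun_eq_iff algebra_simps)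
  from partial_deriv_eq[OF this, of i] i show ?B by (auto simp: axis_def[where 'b=3])
  show ?C
    unfolding helicoid_partials by (rule partial_deriv_eq[OF has_derivative_const])
qed

text \<open>u and v are asymptotic coordinates: the pure second derivatives are multiples of the
  tangent vector in direction u, so only the mixed one has a normal part. The argument treats both
  unit normals alike.\<close>

lemma shape_operator_helicoid:
  assumes "N \<in> unit_normals helicoid (UNIV, id) x"
  obtains q where "q \<noteq> 0" "shape_operator cat_space helicoid (UNIV, id) x N =
    (\<chi> i j. if (i, j) \<in> {(1, 2), (2, 1)} then q else 0)"
proof -
  define C S c s where "C = cosh (x $ 1)" "S = sinh (x $ 1)" "c = cos (x $ 2)" "s = sin (x $ 2)"
  note abb = this
  have tang: "partial_deriv i helicoid x \<bullet> N = 0" for i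
    using assms by (simp add: unit_normals_def partial_deriv_def inner_commute)
  have t: "C * (c * N $ 1 + s * N $ 2) = 0" "S * (c * N $ 2 - s * N $ 1) + N $ 3 = 0" "N $ 4 = 0"
    using tang[of 1] tang[of 2] tang[of 3] unfolding helicoid_partials
    by (simp_all add: inner_add_left inner_axis' abb algebra_simps)
  have "C > 0" by (simp add: abb)
  with t have t1: "c * N $ 1 + s * N $ 2 = 0" by simp
  have "N \<bullet> N = 1"
    using assms by (simp add: unit_normals_def dot_square_norm)
  then have n: "(N $ 1)\<^sup>2 + (N $ 2)\<^sup>2 + (N $ 3)\<^sup>2 = 1"
    using t by (simp add: inner_vec_def sum_4 power2_eq_square)
  have cs: "s\<^sup>2 + c\<^sup>2 = 1" by (simp add: abb)
  \<comment> \<open>The component of \<open>N\<close> along (-s, c, 0, 0), the direction of the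
    mixed second derivative.\<close>
  define r where "r = c * N $ 2 - s * N $ 1"
  \<comment> \<open>Otherwise orthogonality to (c, s) and (-s, c) kills the first two components of
    \<open>N\<close>, and orthogonality to the v direction then kills the third.\<close>
  have "r \<noteq> 0"
  proof
    assume "r = 0"
    then have "(N $ 1)\<^sup>2 + (N $ 2)\<^sup>2 = 0"
      using t1 cs unfolding r_def by algebra
    moreover have "N $ 3 = 0" using t(2) \<open>r = 0\<close> by (simp add: r_def)
    ultimately show False using n by simp
  qed
  \<comment> \<open>The Christoffel terms are tangential, so they vanish against
    \<open>N\<close>.\<close>
  have h: "second_fundamental_form cat_space helicoid (UNIV, id) x i j \<bullet> N =
      partial_deriv i (partial_deriv j helicoid) x \<bullet> N" for i j
    by (simp add: second_fundamental_form_def inner_diff_left inner_sum_left tang)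
  have z: "S * c * N $ 1 + S * s * N $ 2 = 0" using t1 by algebra
  have "\<forall>i j. partial_deriv i (partial_deriv j helicoid) x \<bullet> N =
      (if (i, j) \<in> {(1, 2), (2, 1)} then C * r else 0)"
    unfolding forall_3 helicoid_partials2 using z
    by (simp add: inner_add_left inner_diff_left inner_axis' r_def algebra_simps flip: abb)
  then have "shape_operator cat_space helicoid (UNIV, id) x N =
      (\<chi> i j. if (i, j) \<in> {(1, 2), (2, 1)} then r / C else 0)"
    using \<open>C > 0\<close> by (simp add: shape_operator_def h vec_eq_iff forall_3 matrix_matrix_mult_def sum_3
        matrix_inv_cat_gram power2_eq_square flip: abb)
  with \<open>r \<noteq> 0\<close> \<open>C > 0\<close> show ?thesis
    by (intro that[of "r / C"]) auto
qed

lemma trace_shape_operator_helicoid: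
  assumes "N \<in> unit_normals helicoid (UNIV, id) x"
  shows "trace (shape_operator cat_space helicoid (UNIV, id) x N) = 0"
proof -
  obtain q where "shape_operator cat_space helicoid (UNIV, id) x N =
    (\<chi> i j. if (i, j) \<in> {(1, 2), (2, 1)} then q else 0)"
    using shape_operator_helicoid[OF assms] by blast
  then show ?thesis by (simp add: trace_def sum_3)
qed

text \<open>The operator exchanges the first two components up to the factor \<open>q\<close> and
  annihilates the third; as \<open>q\<close> is nonzero, the eigenvalues \<open>q\<close>,
  \<open>- q\<close> and 0 differ.\<close>

lemma card_principal_curvatures_helicoid:
  assumes "N \<in> unit_normals helicoid (UNIV, id) x"
  shows "card (principal_curvatures cat_space helicoid (UNIV, id) x N) = 3"
proof -
  obtain q where q: "q \<noteq> 0" "shape_operator cat_space helicoid (UNIV, id) x N =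
    (\<chi> i j. if (i, j) \<in> {(1, 2), (2, 1)} then q else 0)"
    using shape_operator_helicoid[OF assms] by blast
  have eig: "shape_operator cat_space helicoid (UNIV, id) x N *v v = \<kappa> *\<^sub>R v \<longleftrightarrow>
      q * v $ 2 = \<kappa> * v $ 1 \<and> q * v $ 1 = \<kappa> * v $ 2 \<and> \<kappa> * v $ 3 = 0" for v \<kappa>
    by (auto simp: q vec_eq_iff matrix_vector_mult_def forall_3 sum_3)
  have "principal_curvatures cat_space helicoid (UNIV, id) x N = {q, - q, 0}"
  proof (intro equalityI subsetI)
    fix \<kappa> assume "\<kappa> \<in> principal_curvatures cat_space helicoid (UNIV, id) x N"
    then obtain v :: "real^3" where v: "v \<noteq> 0" "q * v $ 2 = \<kappa> * v $ 1" "q * v $ 1 = \<kappa> * v $ 2" "\<kappa> * v $ 3 = 0"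
      by (auto simp: principal_curvatures_def eig)
    show "\<kappa> \<in> {q, - q, 0}"
    proof (rule ccontr)
      assume "\<kappa> \<notin> {q, - q, 0}"
      then have "(q - \<kappa>) * (q + \<kappa>) \<noteq> 0" "\<kappa> \<noteq> 0" by (auto simp: add_eq_0_iff)
      \<comment> \<open>Combining the two equations gives q^2 w = \<kappa>^2 w for both components
        w, so they vanish; \<kappa> being nonzero then kills the third.\<close>
      moreover have "(q - \<kappa>) * (q + \<kappa>) * v $ 1 = 0" "(q - \<kappa>) * (q + \<kappa>) * v $ 2 = 0"
        using v(2,3) by algebra+
      ultimately show False
        using v by (auto simp: vec_eq_iff forall_3)
    qed
  next
    fix \<kappa> assume "\<kappa> \<in> {q, - q, 0}"
    then consider "\<kappa> = q" | "\<kappa> = - q" | "\<kappa> = 0" by auto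
    then show "\<kappa> \<in> principal_curvatures cat_space helicoid (UNIV, id) x N"
      unfolding principal_curvatures_def mem_Collect_eq eig
    proof cases
      case 1
      then show "\<exists>v::real^3. v \<noteq> 0 \<and> q * v $ 2 = \<kappa> * v $ 1 \<and> q * v $ 1 = \<kappa> * v $ 2 \<and> \<kappa> * v $ 3 = 0"
        by (intro exI[of _ "vector [1, 1, 0]"]) (simp add: vec_eq_iff forall_3)
    next
      case 2
      then show "\<exists>v::real^3. v \<noteq> 0 \<and> q * v $ 2 = \<kappa> * v $ 1 \<and> q * v $ 1 = \<kappa> * v $ 2 \<and> \<kappa> * v $ 3 = 0"
        by (intro exI[of _ "vector [1, - 1, 0]"]) (simp add: vec_eq_iff forall_3)
    next
      case 3
      then show "\<exists>v::real^3. v \<noteq> 0 \<and> q * v $ 2 = \<kappa> * v $ 1 \<and> q * v $ 1 = \<kappa> * v $ 2 \<and> \<kappa> * v $ 3 = 0"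
        by (intro exI[of _ "vector [0, 0, 1]"]) (simp add: vec_eq_iff forall_3)
    qed
  qed
  with q(1) show ?thesis by simp
qed

theorem proposition5p2:
  shows "\<exists>(M :: (real^3, 3) riem) (f :: real^3 \<Rightarrow> real^4).
    minimal_hypersurface M f \<and> ideal_hypersurface M f \<and>
    three_distinct_principal_curvatures M f \<and> \<not> rigid M f"
proof (intro exI conjI)
  have "hypersurface cat_space helicoid"
    by (simp add: hypersurface_def riemannian_cat_space isometric_helicoid)
  \<comment> \<open>Zero trace makes the mean curvature zero, so ideality reduces to
    \<open>delta_cat\<close>.\<close>
  then show "minimal_hypersurface cat_space helicoid" "ideal_hypersurface cat_space helicoid"
    by (simp_all add: minimal_hypersurface_def ideal_hypersurface_def mean_curvature_def delta_cat
        trace_shape_operator_helicoid)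
  show "three_distinct_principal_curvatures cat_space helicoid"
    by (simp add: three_distinct_principal_curvatures_def card_principal_curvatures_helicoid)
qed (rule not_rigid_helicoid)

end
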